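(* Let $V$ be a vertex superalgebra, and let $A(V,\mathcal D)$ be the associative subalgebra of $\mathrm{End}_{\mathbb{C}}(V)$ generated by the operators $\mathcal D$ and $u_n$ for all $u\in V$, $n\in\mathbb{Z}$, regarded as an ordinary (ungraded) algebra. Then $V$ is a simple vertex superalgebra if and only if the underlying vector space $|V|$ is a simple $A(V,\mathcal D)$-module (in the ordinary, ungraded sense).
   Context: All vector spaces are over $\mathbb{C}$. A vector superspace is a $\mathbb{Z}_2$-graded vector space $V=V_{\bar 0}\oplus V_{\bar 1}$; homogeneous $u\in V_{\bar i}$ has $|u|=i$. A subsuperspace is a subspace $W$ with $W=(W\cap V_{\bar 0})\oplus (W\cap V_{\bar 1})$. $|V|$ denotes the underlying vector space of $V$, with the $\mathbb{Z}_2$-grading forgotten. A vertex superalgebra is a triple $(V,Y(\ ,z),\mathbf 1)$ with $V$ a vector superspace, $\mathbf 1\in V_{\bar 0}$, and a linear map $V\to \mathrm{End}_{\mathbb{C}}(V)[[z,z^{-1}]]$, $v\mapsto Y(v,z)=\sum_{n\in\mathbb{Z}}v_nz^{-n-1}$, such that: (1) for $u,v\in V$, $u_nv=0$ for $n\gg0$; (2) $Y(\mathbf 1,z)=\mathrm{id}_V$ and $Y(v,z)\mathbf 1=v+(v_{-2}\mathbf 1)z+\cdots\in V[[z]]$; (3) $u_nv\in V_{\alpha+\beta}$ for $u\in V_\alpha$, $v\in V_\beta$, $n\in\mathbb{Z}$; (4) for homogeneous $u,v,w$, $$z_0^{-1}\delta\left(\tfrac{z_1-z_2}{z_0}\right)Y(u,z_1)Y(v,z_2)w-(-1)^{|u||v|}z_0^{-1}\delta\left(\tfrac{z_2-z_1}{-z_0}\right)Y(v,z_2)Y(u,z_1)w=z_2^{-1}\delta\left(\tfrac{z_1-z_0}{z_2}\right)Y(Y(u,z_0)v,z_2)w,$$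 where $\delta(z)=\sum_{n\in\mathbb{Z}}z^n$ and binomial powers are expanded in nonnegative powers of the second variable. $\mathcal D\colon V\to V$ is the even linear map $\mathcal D(v)=v_{-2}\mathbf 1$. An ideal of $V$ is a subsuperspace $I\subseteq V$ such that $u_nI\subseteq I$ for all $u\in V$, $n\in\mathbb{Z}$, and $u_nv\in I$ for all $u\in I$, $v\in V$, $n\in\mathbb{Z}$. $V$ is simple if it has no nonzero proper ideals (ideals are required to be $\mathbb{Z}_2$-graded). Correspondingly, "simple module" here means a module with no nonzero proper submodules (submodules are arbitrary, not necessarily $\mathbb{Z}_2$-graded); the same convention about the zero object is used on both sides. *)

theory Defs
  imports Complex_Main "HOL-Library.Z2" "HOL-Library.Groups_Big_Fun"
begin

locale vector_superspace = vector_space scale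
  for scale :: "complex \<Rightarrow> 'v::ab_group_add \<Rightarrow> 'v" (infixr "*s" 75) +
  fixes gr :: "bit \<Rightarrow> 'v set"
  assumes subspace_gr: "subspace (gr i)"
    and gr_Int: "gr 0 \<inter> gr 1 = {0}"
    and gr_sum: "\<exists>x\<in>gr 0. \<exists>y\<in>gr 1. v = x + y"
begin

definition subsuperspace :: "'v set \<Rightarrow> bool" where
  "subsuperspace W \<longleftrightarrow> subspace W \<and> W = {x + y |x y. x \<in> W \<inter> gr 0 \<and> y \<in> W \<inter> gr 1}"

end

definition super_sign :: "bit \<Rightarrow> bit \<Rightarrow> complex" where
  "super_sign \<alpha> \<beta> = (if \<alpha> * \<beta> = 1 then - 1 else 1)"

text \<open>
  A formal series in \<open>x\<close>, \<open>y\<close>, ... with integer exponents is represented by its coefficient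
  function. \<open>diff_power n p q\<close> is the coefficient of \<open>x^p y^q\<close> in \<open>(x - y)^n\<close>, expanded in
  nonnegative powers of \<open>y\<close>.
\<close>
definition diff_power :: "int \<Rightarrow> int \<Rightarrow> int \<Rightarrow> complex" where
  "diff_power n p q =
    (if q \<ge> 0 \<and> p + q = n then (- 1) ^ nat q * (of_int n gchoose nat q) else 0)"

text \<open>
  The coefficient of \<open>z^r x^p y^q\<close> in \<open>z^-1 \<delta>((x - y) / (\<epsilon> z))\<close>, that is, in the sum over all
  integers \<open>n\<close> of \<open>z^-1 (\<epsilon> z)^-n (x - y)^n\<close>, where only \<open>n = -r - 1\<close> contributes.
\<close>
definition delta_coeff :: "complex \<Rightarrow> int \<Rightarrow> int \<Rightarrow> int \<Rightarrow> complex" where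
  "delta_coeff \<epsilon> r p q = \<epsilon> powi (r + 1) * diff_power (- r - 1) p q"

text \<open>
  Product of a scalar valued and a vector valued formal series in \<open>z\<^sub>0, z\<^sub>1, z\<^sub>2\<close>; arguments are the
  exponents in this order. It is meaningful only if each coefficient is a finite sum
  (\<^const>\<open>Sum_any\<close> returns \<open>0\<close> on infinite support). For the three products in the Jacobi
  identity below this is guaranteed by the truncation axiom.
\<close>
definition series_mult ::
    "(complex \<Rightarrow> 'v \<Rightarrow> 'v) \<Rightarrow> (int \<Rightarrow> int \<Rightarrow> int \<Rightarrow> complex) \<Rightarrow>
      (int \<Rightarrow> int \<Rightarrow> int \<Rightarrow> 'v) \<Rightarrow> int \<Rightarrow> int \<Rightarrow> int \<Rightarrow> 'v::comm_monoid_add" where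
  "series_mult scale K F a b c =
    Sum_any (\<lambda>(i, j, k). scale (K i j k) (F (a - i) (b - j) (c - k)))"

text \<open>
  \<open>Y u n\<close> is the mode \<open>u\<^sub>n\<close>, so the coefficient of \<open>z^p\<close> in \<open>Y(u, z)\<close> is \<open>Y u (- p - 1)\<close>.
\<close>
locale vertex_superalgebra = vector_superspace scale gr
  for scale :: "complex \<Rightarrow> 'v::ab_group_add \<Rightarrow> 'v" (infixr "*s" 75)
    and gr :: "bit \<Rightarrow> 'v set" +
  fixes Y :: "'v \<Rightarrow> int \<Rightarrow> 'v \<Rightarrow> 'v"
    and vac :: 'v
  assumes vac_even: "vac \<in> gr 0"
    and linear_mode: "Vector_Spaces.linear scale scale (Y u n)"
    and linear_state: "Vector_Spaces.linear scale scale (\<lambda>u. Y u n v)"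
    and truncation: "\<exists>N. \<forall>n\<ge>N. Y u n v = 0"
    and vacuum: "Y vac n v = (if n = - 1 then v else 0)"
    and creation_regular: "n \<ge> 0 \<Longrightarrow> Y v n vac = 0"
    and creation: "Y v (- 1) vac = v"
    and parity: "u \<in> gr \<alpha> \<Longrightarrow> v \<in> gr \<beta> \<Longrightarrow> Y u n v \<in> gr (\<alpha> + \<beta>)"
    and Jacobi: "u \<in> gr \<alpha> \<Longrightarrow> v \<in> gr \<beta> \<Longrightarrow> w \<in> gr \<gamma> \<Longrightarrow>
      series_mult scale (\<lambda>i j k. delta_coeff 1 i j k)
        (\<lambda>i j k. if i = 0 then Y u (- j - 1) (Y v (- k - 1) w) else 0) a b c
      - super_sign \<alpha> \<beta> *s series_mult scale (\<lambda>i j k. delta_coeff (- 1) i k j)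
        (\<lambda>i j k. if i = 0 then Y v (- k - 1) (Y u (- j - 1) w) else 0) a b c
      = series_mult scale (\<lambda>i j k. delta_coeff 1 k j i)
        (\<lambda>i j k. if j = 0 then Y (Y u (- i - 1) v) (- k - 1) w else 0) a b c"
begin

definition D :: "'v \<Rightarrow> 'v" where
  "D v = Y v (- 2) vac"

definition ideal :: "'v set \<Rightarrow> bool" where
  "ideal I \<longleftrightarrow> subsuperspace I \<and>
    (\<forall>u n. \<forall>x\<in>I. Y u n x \<in> I) \<and> (\<forall>u\<in>I. \<forall>n v. Y u n v \<in> I)"

definition simple_vertex_superalgebra :: bool where
  "simple_vertex_superalgebra \<longleftrightarrow> (\<forall>I. ideal I \<longrightarrow> I = {0} \<or> I = UNIV)"

end

context vector_space
begin

definition End_subalgebra :: "('b \<Rightarrow> 'b) set \<Rightarrow> bool" where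
  "End_subalgebra A \<longleftrightarrow> (\<forall>f\<in>A. Vector_Spaces.linear scale scale f) \<and>
    id \<in> A \<and> (\<lambda>_. 0) \<in> A \<and>
    (\<forall>f\<in>A. \<forall>g\<in>A. (\<lambda>x. f x + g x) \<in> A) \<and>
    (\<forall>c. \<forall>f\<in>A. (\<lambda>x. scale c (f x)) \<in> A) \<and>
    (\<forall>f\<in>A. \<forall>g\<in>A. f \<circ> g \<in> A)"

definition simple_module :: "('b \<Rightarrow> 'b) set \<Rightarrow> bool" where
  "simple_module A \<longleftrightarrow>
    (\<forall>W. subspace W \<and> (\<forall>f\<in>A. f ` W \<subseteq> W) \<longrightarrow> W = {0} \<or> W = UNIV)"

end

context vertex_superalgebra
begin

text \<open>
  Including \<open>id\<close> in \<^const>\<open>End_subalgebra\<close> makes no difference here, since \<open>id = Y vac (- 1)\<close> is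
  one of the generators.
\<close>
definition mode_algebra :: "('v \<Rightarrow> 'v) set" where
  "mode_algebra = End_subalgebra hull insert D {Y u n |u n. True}"

end

end

theory Submission
  imports Defs
begin

text \<open>
  Skew symmetry \<open>v\<^sub>r u = \<plusminus>\<Sum>i. (-1)^(r+i+1) D^i/i! (u\<^bsub>r+i\<^esub> v)\<close> makes every graded
  \<open>A(V, D)\<close>-submodule an ideal, so only ungraded submodules \<open>W\<close> are at issue. If \<open>V\<close> is simple,
  the largest graded subspace of \<open>W\<close> and the smallest graded subspace containing \<open>W\<close>, being
  ideals, are \<open>0\<close> or \<open>V\<close>. In the one critical case they are \<open>0\<close> and \<open>V\<close>, respectively; then
  \<open>1 + e \<in> W\<close> for some odd \<open>e\<close>. For \<open>n \<ge> 0\<close> the even vector \<open>e\<^sub>n e = e\<^sub>n (1 + e)\<close> lies in \<open>W\<close>, so it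
  vanishes, and skew symmetry gives \<open>e\<^bsub>-1\<^esub> e = - e\<^bsub>-1\<^esub> e\<close>, so \<open>e\<^bsub>-1\<^esub> e = 0\<close> as well. Hence
  \<open>e = e\<^bsub>-1\<^esub> (1 + e) \<in> W\<close>, so \<open>e = 0\<close>, the vacuum lies in \<open>W\<close>, and \<open>V = 0\<close>.
\<close>

section \<open>Coefficients of products of formal series\<close>

lemma (in vector_superspace) series_mult_eq_sum:
  assumes "finite A" "inj_on h A"
    and supp: "\<And>i j k. K i j k \<noteq> 0 \<Longrightarrow> F (a - i) (b - j) (c - k) \<noteq> 0 \<Longrightarrow> (i, j, k) \<in> h ` A"
  shows "series_mult scale K F a b c =
    (\<Sum>x\<in>A. case h x of (i, j, k) \<Rightarrow> K i j k *s F (a - i) (b - j) (c - k))"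
proof -
  let ?g = "\<lambda>(i, j, k). K i j k *s F (a - i) (b - j) (c - k)"
  have "series_mult scale K F a b c = sum ?g (h ` A)"
    unfolding series_mult_def using assms by (intro Sum_any.expand_superset) auto
  then show ?thesis
    using sum.reindex[OF assms(2), of ?g] by simp
qed

text \<open>These are the coefficients of (1 - y)^(-2); they produce the factor k + 1 in
  \<open>D_mode_vac\<close>.\<close>

lemma minus_one_power_mult_gchoose_minus_two:
  "(- 1) ^ k * ((- 2 :: 'a::field_char_0) gchoose k) = of_nat (Suc k)"
proof -
  have "((of_nat (Suc k) :: 'a) gchoose k) = of_nat (Suc k)"
    by (subst binomial_gbinomial[symmetric]) simp
  moreover have "(- 2 :: 'a) gchoose k = (- 1) ^ k * (of_nat (Suc k) gchoose k)"
    using gbinomial_minus[of "2 :: 'a" k] by (simp add: algebra_simps)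
  ultimately show ?thesis
    by (simp flip: power_add mult.assoc mult_2)
qed

section \<open>Graded subspaces\<close>

lemma (in vector_superspace) homogeneous_decomposition:
  obtains x y where "x \<in> gr 0" "y \<in> gr 1" "v = x + y"
  using gr_sum by blast

lemma (in vector_superspace) subsuperspace_sum:
  assumes "\<And>i. subspace (A i)" "\<And>i. A i \<subseteq> gr i"
  shows "subsuperspace {x + y |x y. x \<in> A 0 \<and> y \<in> A 1}"
proof -
  define I where "I = {x + y |x y. x \<in> A 0 \<and> y \<in> A 1}"
  have sub: "subspace I"
    using subspace_sums[OF assms(1) assms(1)] by (simp add: I_def)
  have "x \<in> I" if "x \<in> A i" for x i
    using that subspace_0[OF assms(1)] unfolding I_def by (cases i) force+
  then have "x \<in> I \<inter> gr i" if "x \<in> A i" for x i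
    using that assms(2) by blast
  then have "I \<subseteq> {x + y |x y. x \<in> I \<inter> gr 0 \<and> y \<in> I \<inter> gr 1}"
    by (subst I_def) blast
  moreover have "{x + y |x y. x \<in> I \<inter> gr 0 \<and> y \<in> I \<inter> gr 1} \<subseteq> I"
    using subspace_add[OF sub] by blast
  ultimately have "subsuperspace I"
    using sub unfolding subsuperspace_def by blast
  then show ?thesis
    by (simp add: I_def)
qed

section \<open>Modes, skew symmetry and the operator D\<close>

context vertex_superalgebra
begin

lemma mode_add_right: "Y u n (x + y) = Y u n x + Y u n y"
  and mode_zero_right [simp]: "Y u n 0 = 0"
proof -
  interpret l: Vector_Spaces.linear scale scale "Y u n" by (rule linear_mode)
  show "Y u n (x + y) = Y u n x + Y u n y" "Y u n 0 = 0"
    by (fact l.add l.zero)+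
qed

lemma mode_add_left: "Y (x + y) n v = Y x n v + Y y n v"
  and mode_zero_left [simp]: "Y 0 n v = 0"
proof -
  interpret l: Vector_Spaces.linear scale scale "\<lambda>u. Y u n v" by (rule linear_state)
  show "Y (x + y) n v = Y x n v + Y y n v" "Y 0 n v = 0"
    by (fact l.add l.zero)+
qed

lemma mode_mode_vac_nonzero: "Y v m (Y u n vac) \<noteq> 0 \<Longrightarrow> n < 0"
  by (rule ccontr) (simp add: creation_regular)

lemma linear_D: "Vector_Spaces.linear scale scale D"
  unfolding D_def by (rule linear_state)

lemma D_add: "D (x + y) = D x + D y"
  by (simp add: D_def mode_add_left)

lemma D_homogeneous: "x \<in> gr i \<Longrightarrow> D x \<in> gr i"
  unfolding D_def using parity[of x i vac 0] vac_even by (metis add.right_neutral)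

lemma zero_mem_gr [simp]: "0 \<in> gr i"
  using subspace_gr subspace_0 by blast

text \<open>The coefficient of \<open>z\<^sub>0^(-r-1) z\<^sub>1^0 z\<^sub>2^-1\<close> in the Jacobi identity applied to the vacuum.\<close>

lemma skew_symmetry:
  assumes u: "u \<in> gr \<alpha>" and v: "v \<in> gr \<beta>"
    and N: "\<And>i. i \<ge> N \<Longrightarrow> Y u (r + int i) v = 0"
  shows "Y v r u = (- super_sign \<alpha> \<beta> * (- 1) powi r) *s
    (\<Sum>i<N. (- 1) ^ i *s Y (Y u (r + int i) v) (- 1 - int i) vac)"
proof -
  let ?S = "\<Sum>i<N. (- 1) ^ i *s Y (Y u (r + int i) v) (- 1 - int i) vac"
  have 1: "series_mult scale (\<lambda>i j k. delta_coeff 1 i j k)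
        (\<lambda>i j k. if i = 0 then Y u (- j - 1) (Y v (- k - 1) vac) else 0) (- r - 1) 0 (- 1) = 0"
    \<comment> \<open>The delta coefficient forces k \<ge> 0, and the inner mode is v_k, which kills
      the vacuum.\<close>
    by (subst series_mult_eq_sum[where A = "{}"])
      (auto simp: delta_coeff_def diff_power_def creation_regular split: if_split_asm)
  have 2: "series_mult scale (\<lambda>i j k. delta_coeff (- 1) i k j)
        (\<lambda>i j k. if i = 0 then Y v (- k - 1) (Y u (- j - 1) vac) else 0) (- r - 1) 0 (- 1)
      = (- 1) powi r *s Y v r u"
    \<comment> \<open>Here j \<ge> 0 and the inner mode is u_(j-1), so only j = 0 survives, where it
      creates \<open>u\<close>; then k = r.\<close>
    by (subst series_mult_eq_sum[where A = "{()}" and h = "\<lambda>_. (- r - 1, 0, r)"])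
      (auto simp: delta_coeff_def diff_power_def creation power_int_minus
        simp flip: power_int_inverse dest!: mode_mode_vac_nonzero split: if_split_asm)
  have 3: "series_mult scale (\<lambda>i j k. delta_coeff 1 k j i)
        (\<lambda>i j k. if j = 0 then Y (Y u (- i - 1) v) (- k - 1) vac else 0) (- r - 1) 0 (- 1) = ?S"
  \<comment> \<open>The exponents are forced to j = 0 and k = - i - 1, so the binomial coefficient
    is (i choose i) = 1; the bound \<open>N\<close> makes the sum finite.\<close>
  proof (subst series_mult_eq_sum[where A = "{..<N}" and h = "\<lambda>i. (int i, 0, - int i - 1)"],
      goal_cases)
    case (3 i j k)
    then have *: "i \<ge> 0" "j = 0" "k = - i - 1"
      by (auto simp: delta_coeff_def diff_power_def split: if_split_asm)
    have "- (- r - 1 - i) - 1 = r + int (nat i)"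
      using * by simp
    with 3(2) have "Y u (r + int (nat i)) v \<noteq> 0"
      by (auto simp: add.commute simp del: int_nat_eq split: if_split_asm)
    with N have "nat i < N"
      by (meson not_le)
    with * show ?case
      by (intro image_eqI[of _ _ "nat i"]) auto
  next
    case 4
    show ?case
    proof (intro sum.cong refl)
      fix i
      have "Y (Y u (int i + r) v) (- int i - 1) vac = Y (Y u (r + int i) v) (- 1 - int i) vac"
        by (metis add.commute minus_diff_commute)
      then show "(case (int i, 0, - int i - 1) of (i, j, k) \<Rightarrow> delta_coeff 1 k j i *s
          (if 0 - j = 0 then Y (Y u (- (- r - 1 - i) - 1) v) (- (- 1 - k) - 1) vac else 0))
        = (- 1) ^ i *s Y (Y u (r + int i) v) (- 1 - int i) vac"
        by (simp add: delta_coeff_def diff_power_def flip: binomial_gbinomial)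
    qed
  qed (auto simp: inj_on_def)
  let ?c = "- super_sign \<alpha> \<beta> * (- 1) powi r"
  have S: "?S = ?c *s Y v r u"
    using Jacobi[OF u v vac_even, of "- r - 1" 0 "- 1"] unfolding 1 2 3 by simp
  have "?c * ?c = 1"
    by (simp add: super_sign_def power_int_minus_left)
  then show ?thesis
    unfolding S scale_scale by simp
qed

text \<open>The coefficient of \<open>z\<^sub>0 z\<^sub>1^-1 z\<^sub>2^k\<close> in the Jacobi identity for \<open>a\<close> and two vacua.\<close>

lemma D_mode_vac:
  assumes a: "a \<in> gr \<alpha>"
  shows "Y (D a) (- 1 - int k) vac = of_nat (Suc k) *s Y a (- 2 - int k) vac"
proof -
  have 1: "series_mult scale (\<lambda>i j k. delta_coeff 1 i j k)
        (\<lambda>i j k. if i = 0 then Y a (- j - 1) (Y vac (- k - 1) vac) else 0) 1 (- 1) (int k)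
      = of_nat (Suc k) *s Y a (- 2 - int k) vac"
  \<comment> \<open>The mode of \<open>vac\<close> must have index -1, which fixes the exponent of
    z_2; the total degree -2 of the delta coefficient then fixes that of z_1.\<close>
  proof (subst series_mult_eq_sum[where A = "{()}" and h = "\<lambda>_. (1, - 2 - int k, int k)"],
      goal_cases)
    case 4
    show ?case
      using minus_one_power_mult_gchoose_minus_two[of k, where 'a = complex]
      by (simp add: delta_coeff_def diff_power_def vacuum)
  qed (auto simp: delta_coeff_def diff_power_def vacuum split: if_split_asm)
  have 2: "series_mult scale (\<lambda>i j k. delta_coeff (- 1) i k j)
        (\<lambda>i j k. if i = 0 then Y vac (- k - 1) (Y a (- j - 1) vac) else 0) 1 (- 1) (int k) = 0"
    by (subst series_mult_eq_sum[where A = "{}"])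
      (auto simp: delta_coeff_def diff_power_def creation_regular split: if_split_asm)
  have 3: "series_mult scale (\<lambda>i j k. delta_coeff 1 k j i)
        (\<lambda>i j k. if j = 0 then Y (Y a (- i - 1) vac) (- k - 1) vac else 0) 1 (- 1) (int k)
      = Y (D a) (- 1 - int k) vac"
  \<comment> \<open>The coefficient contains (i - 1 choose i) with i \<ge> 0, which vanishes unless
    i = 0; there the inner vector is a_(-2) vac = \<open>D a\<close>.\<close>
  proof (subst series_mult_eq_sum[where A = "{()}" and h = "\<lambda>_. (0, - 1, 0)"], goal_cases)
    case (3 i j l)
    then have *: "i \<ge> 0" "j = - 1" "l = - i" "(of_int (i - 1) gchoose nat i :: complex) \<noteq> 0"
      by (auto simp: delta_coeff_def diff_power_def split: if_split_asm)
    have "i = 0"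
    proof (rule ccontr)
      assume "i \<noteq> 0"
      with * have "(of_int (i - 1) :: complex) = of_nat (nat i - 1)"
        by simp
      with *(4) have "of_nat ((nat i - 1) choose nat i) \<noteq> (0 :: complex)"
        by (simp only: binomial_gbinomial not_False_eq_True)
      with * \<open>i \<noteq> 0\<close> show False
        by (simp add: binomial_eq_0)
    qed
    with * show ?case
      by simp
  qed (auto simp: delta_coeff_def diff_power_def D_def algebra_simps)
  from Jacobi[OF a vac_even vac_even, of 1 "- 1" "int k"] show ?thesis
    unfolding 1 2 3 by simp
qed

text \<open>Iterating \<open>D_mode_vac\<close> gives a_(-1-k) vac = D^k a / k!, so closure under
  \<open>D\<close> suffices.\<close>

lemma mode_vac_mem:
  assumes W: "subspace W" and D: "\<And>x. x \<in> W \<Longrightarrow> D x \<in> W"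
    and a: "a \<in> W" "a \<in> gr \<alpha>"
  shows "Y a (- 1 - int k) vac \<in> W"
  using a
proof (induction k arbitrary: a)
  case 0
  then show ?case
    by (simp add: creation)
next
  case (Suc k)
  have "- 2 - int k = - 1 - int (Suc k)"
    by simp
  with Suc.IH[OF D D_homogeneous] Suc.prems D_mode_vac[of a \<alpha> k]
  have "of_nat (Suc k) *s Y a (- 1 - int (Suc k)) vac \<in> W"
    by metis
  from subspace_scale[OF W this, of "inverse (of_nat (Suc k))"] show ?case
    by (simp del: of_nat_Suc)
qed

section \<open>Ideals from graded submodules\<close>

text \<open>Only the left action on \<open>A\<close> is assumed. Skew symmetry writes x_n u through
  vacuum modes of the vectors u_m x, and \<open>mode_vac_mem\<close> keeps these in the right graded
  piece.\<close>

lemma ideal_sum: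
  assumes sub: "\<And>i. subspace (A i)" and gr: "\<And>i. A i \<subseteq> gr i"
    and mode: "\<And>\<alpha> \<beta> u n x. u \<in> gr \<alpha> \<Longrightarrow> x \<in> A \<beta> \<Longrightarrow> Y u n x \<in> A (\<alpha> + \<beta>)"
    and D: "\<And>i x. x \<in> A i \<Longrightarrow> D x \<in> A i"
  shows "ideal {x + y |x y. x \<in> A 0 \<and> y \<in> A 1}" (is "ideal ?I")
proof -
  have super: "subsuperspace ?I"
    using sub gr by (rule subsuperspace_sum)
  then have I: "subspace ?I"
    unfolding subsuperspace_def by (rule conjunct1)
  have A_I: "x \<in> ?I" if "x \<in> A i" for x i
    using that subspace_0[OF sub] by (cases i) force+
  have right: "Y x n u \<in> A (\<alpha> + \<beta>)" if u: "u \<in> gr \<alpha>" and x: "x \<in> A \<beta>" for \<alpha> \<beta> u n x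
  proof -
    obtain M where M: "\<And>m. m \<ge> M \<Longrightarrow> Y u m x = 0"
      using truncation by blast
    have "Y u (n + int i) x = 0" if "i \<ge> nat (M - n)" for i
      using that by (intro M) linarith
    moreover have "x \<in> gr \<beta>"
      using x gr by blast
    ultimately have "Y x n u = (- super_sign \<alpha> \<beta> * (- 1) powi n) *s
        (\<Sum>i<nat (M - n). (- 1) ^ i *s Y (Y u (n + int i) x) (- 1 - int i) vac)"
      using u by (intro skew_symmetry)
    also have "\<dots> \<in> A (\<alpha> + \<beta>)"
    proof (intro subspace_scale subspace_sum sub)
      fix i
      have "Y u (n + int i) x \<in> A (\<alpha> + \<beta>)"
        using u x by (rule mode)
      then show "Y (Y u (n + int i) x) (- 1 - int i) vac \<in> A (\<alpha> + \<beta>)"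
        using gr by (intro mode_vac_mem[OF sub D]) auto
    qed
    finally show ?thesis .
  qed
  have "Y u n z \<in> ?I \<and> Y z n u \<in> ?I" if z: "z \<in> ?I" for u n z
  proof -
    obtain u0 u1 where u: "u0 \<in> gr 0" "u1 \<in> gr 1" "u = u0 + u1"
      by (rule homogeneous_decomposition)
    obtain x y where xy: "x \<in> A 0" "y \<in> A 1" "z = x + y"
      using z by blast
    show ?thesis
      unfolding u xy mode_add_left mode_add_right
      by (intro conjI subspace_add[OF I]) (rule A_I, (rule mode right), fact, fact)+
  qed
  then show ?thesis
    using super unfolding ideal_def by blast
qed

section \<open>Submodules over the mode algebra\<close>

definition submodule :: "'v set \<Rightarrow> bool" where
  "submodule W \<longleftrightarrow> subspace W \<and> (\<forall>x\<in>W. D x \<in> W) \<and> (\<forall>u n. \<forall>x\<in>W. Y u n x \<in> W)"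

text \<open>The linear maps preserving \<open>W\<close> form a subalgebra \<open>E\<close>, so
  invariance may be tested on the generators.\<close>

lemma submodule_iff:
  "submodule W \<longleftrightarrow> subspace W \<and> (\<forall>f\<in>mode_algebra. f ` W \<subseteq> W)"
proof
  assume W: "submodule W"
  then have sub: "subspace W"
    by (simp add: submodule_def)
  define E where "E = {f. Vector_Spaces.linear scale scale f \<and> f ` W \<subseteq> W}"
  interpret vector_space_pair scale scale ..
  have "End_subalgebra E"
    unfolding End_subalgebra_def E_def
    using subspace_0[OF sub] subspace_add[OF sub] subspace_scale[OF sub]
    by (auto simp: linear_id linear_zero image_subset_iff
        intro!: linear_compose_add linear_compose_scale_right Vector_Spaces.linear_compose)
  moreover have "insert D {Y u n |u n. True} \<subseteq> E"
    using W linear_D linear_mode by (auto simp: E_def submodule_def)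
  ultimately have "mode_algebra \<subseteq> E"
    unfolding mode_algebra_def by (intro hull_minimal)
  then show "subspace W \<and> (\<forall>f\<in>mode_algebra. f ` W \<subseteq> W)"
    using sub by (auto simp: E_def)
next
  assume W: "subspace W \<and> (\<forall>f\<in>mode_algebra. f ` W \<subseteq> W)"
  have "insert D {Y u n |u n. True} \<subseteq> mode_algebra"
    unfolding mode_algebra_def by (rule hull_subset)
  then show "submodule W"
    using W unfolding submodule_def by blast
qed

lemma simple_module_mode_algebra_iff:
  "simple_module mode_algebra \<longleftrightarrow> (\<forall>W. submodule W \<longrightarrow> W = {0} \<or> W = UNIV)"
  unfolding simple_module_def submodule_iff ..

text \<open>Stability under \<open>D\<close> comes from the second ideal condition, as D x = x_(-2)
  vac.\<close>

lemma ideal_imp_submodule: "ideal I \<Longrightarrow> submodule I"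
  by (auto simp: ideal_def submodule_def subsuperspace_def D_def)

lemma ideal_homogeneous_part:
  assumes W: "submodule W"
  shows "ideal {x + y |x y. x \<in> W \<inter> gr 0 \<and> y \<in> W \<inter> gr 1}"
  using assms D_homogeneous parity
  by (intro ideal_sum[where A = "\<lambda>i. W \<inter> gr i"])
    (auto simp: submodule_def intro: subspace_inter subspace_gr)

text \<open>\<open>A i\<close> is the projection of \<open>W\<close> to \<open>gr i\<close>, the
  witness y being the component of opposite parity. Homogeneous modes and \<open>D\<close> act on
  both components separately, hence preserve these projections.\<close>

lemma ideal_homogeneous_closure:
  assumes W: "submodule W"
  defines "A \<equiv> \<lambda>i. {x \<in> gr i. \<exists>y \<in> gr (i + 1). x + y \<in> W}"
  shows "ideal {x + y |x y. x \<in> A 0 \<and> y \<in> A 1}"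
proof (rule ideal_sum)
  have sub: "subspace W"
    and D: "\<And>x. x \<in> W \<Longrightarrow> D x \<in> W" and mode: "\<And>u n x. x \<in> W \<Longrightarrow> Y u n x \<in> W"
    using W by (auto simp: submodule_def)
  show "subspace (A i)" for i
  proof (rule subspaceI)
    show "0 \<in> A i"
      using subspace_0[OF sub] by (auto simp: A_def intro!: bexI[of _ 0])
  next
    fix x x' assume "x \<in> A i" "x' \<in> A i"
    then obtain y y' where *: "x \<in> gr i" "x' \<in> gr i" "y \<in> gr (i + 1)" "y' \<in> gr (i + 1)"
      "x + y \<in> W" "x' + y' \<in> W"
      by (auto simp: A_def)
    from subspace_add[OF sub *(5,6)] have "(x + x') + (y + y') \<in> W"
      by (simp add: algebra_simps)
    with * subspace_add[OF subspace_gr] show "x + x' \<in> A i"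
      unfolding A_def by blast
  next
    fix c x assume "x \<in> A i"
    then obtain y where *: "x \<in> gr i" "y \<in> gr (i + 1)" "x + y \<in> W"
      by (auto simp: A_def)
    from subspace_scale[OF sub *(3), of c] have "c *s x + c *s y \<in> W"
      by (simp add: scale_right_distrib)
    with * subspace_scale[OF subspace_gr] show "c *s x \<in> A i"
      unfolding A_def by blast
  qed
  show "A i \<subseteq> gr i" for i
    by (auto simp: A_def)
  show "Y u n x \<in> A (\<alpha> + \<beta>)" if u: "u \<in> gr \<alpha>" and x: "x \<in> A \<beta>" for \<alpha> \<beta> u n x
  proof -
    obtain y where *: "x \<in> gr \<beta>" "y \<in> gr (\<beta> + 1)" "x + y \<in> W"
      using x unfolding A_def by blast
    from mode[OF *(3), of u n] have "Y u n x + Y u n y \<in> W"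
      by (simp add: mode_add_right)
    moreover have "Y u n x \<in> gr (\<alpha> + \<beta>)" "Y u n y \<in> gr (\<alpha> + \<beta> + 1)"
      using parity[OF u *(1)] parity[OF u *(2)] by (simp_all only: add.assoc)
    ultimately show ?thesis
      unfolding A_def by blast
  qed
  show "D x \<in> A i" if x: "x \<in> A i" for x i
  proof -
    obtain y where *: "x \<in> gr i" "y \<in> gr (i + 1)" "x + y \<in> W"
      using x unfolding A_def by blast
    from D[OF *(3)] have "D x + D y \<in> W"
      by (simp add: D_add)
    with * D_homogeneous show ?thesis
      unfolding A_def by blast
  qed
qed

section \<open>Ungraded submodules and simplicity\<close>

lemma vac_mem_imp_UNIV:
  assumes "submodule W" "vac \<in> W"
  shows "W = UNIV"
  using assms creation unfolding submodule_def by (metis UNIV_eq_I)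

lemma vac_plus_odd_mem_imp_UNIV:
  assumes W: "submodule W" and hom: "\<And>i. W \<inter> gr i = {0}"
    and e: "e \<in> gr 1" "vac + e \<in> W"
  shows "W = UNIV"
proof -
  have mode: "Y e n vac + Y e n e \<in> W" for n
    using W e(2) by (auto simp: submodule_def simp flip: mode_add_right)
  \<comment> \<open>The first summand of \<open>mode\<close> vanishes, and e_n e is even because 1 +
    1 = 0 in \<open>bit\<close>.\<close>
  have zero: "Y e n e = 0" if "n \<ge> 0" for n
    using mode[of n] creation_regular[OF that] hom[of 0] parity[OF e(1) e(1), of n] by auto
  \<comment> \<open>By \<open>zero\<close> the bound 1 is admissible, so only i = 0 remains; the
    super sign -1 of two odd vectors makes the total factor -1.\<close>
  have "Y e (- 1) e = - Y e (- 1) e"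
    using skew_symmetry[OF e(1) e(1), of 1 "- 1"] zero
    by (simp add: super_sign_def creation)
  then have "2 *s Y e (- 1) e = 0"
    by (metis add.right_inverse one_add_one scale_left_distrib scale_one)
  then have "Y e (- 1) e = 0"
    by simp
  then have "e \<in> W"
    using mode[of "- 1"] by (simp add: creation)
  then have "e = 0"
    using hom e(1) by blast
  then show ?thesis
    using vac_mem_imp_UNIV[OF W] e(2) by simp
qed

lemma simple_iff_simple_module:
  "simple_vertex_superalgebra \<longleftrightarrow> simple_module mode_algebra"
proof
  assume "simple_module mode_algebra"
  then show simple_vertex_superalgebra
    unfolding simple_module_mode_algebra_iff simple_vertex_superalgebra_def
    using ideal_imp_submodule by blast
next
  assume simple_vertex_superalgebra
  then have simple: "I = {0} \<or> I = UNIV" if "ideal I" for I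
    using that by (auto simp: simple_vertex_superalgebra_def)
  have "W = {0} \<or> W = UNIV" if W: "submodule W" for W
  proof -
    have sub: "subspace W"
      using W by (simp add: submodule_def)
    define S where "S = {x + y |x y. x \<in> W \<inter> gr 0 \<and> y \<in> W \<inter> gr 1}"
    define A where "A = (\<lambda>i. {x \<in> gr i. \<exists>y \<in> gr (i + 1). x + y \<in> W})"
    define T where "T = {x + y |x y. x \<in> A 0 \<and> y \<in> A 1}"
    have "W \<subseteq> T"
    proof
      fix w assume w: "w \<in> W"
      obtain x y where xy: "x \<in> gr 0" "y \<in> gr 1" "w = x + y"
        by (rule homogeneous_decomposition)
      with w have "x \<in> A 0" "y \<in> A 1"
        by (auto simp: A_def add.commute)
      with xy(3) show "w \<in> T"
        unfolding T_def by blast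
    qed
    \<comment> \<open>\<open>S\<close> and \<open>T\<close> enclose \<open>W\<close>, so the first
      two cases determine it at once.\<close>
    consider "S = UNIV" | "T = {0}" | "S = {0}" "T = UNIV"
      using simple[OF ideal_homogeneous_part[OF W]] simple[OF ideal_homogeneous_closure[OF W]]
      unfolding S_def T_def A_def by blast
    then show ?thesis
    proof cases
      case 1
      have "S \<subseteq> W"
        using subspace_add[OF sub] by (auto simp: S_def)
      with 1 show ?thesis
        by auto
    next
      case 2
      with \<open>W \<subseteq> T\<close> subspace_0[OF sub] show ?thesis
        by auto
    next
      case 3
      have "W \<inter> gr i \<subseteq> S" for i
        using subspace_0[OF sub] by (cases i) (force simp: S_def)+
      then have hom: "W \<inter> gr i = {0}" for i
        using 3(1) subspace_0[OF sub] by auto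
      \<comment> \<open>As \<open>vac\<close> is even, its odd part y is 0; hence \<open>vac\<close>
        lies in \<open>A 0\<close>, and the definition of \<open>A\<close> supplies the odd
        e.\<close>
      obtain x y where xy: "x \<in> A 0" "y \<in> A 1" "vac = x + y"
        using 3(2) unfolding T_def by blast
      then have "x \<in> gr 0" "y \<in> gr 1"
        by (auto simp: A_def)
      moreover from this have "y \<in> gr 0"
        using subspace_diff[OF subspace_gr vac_even, of x] xy(3) by simp
      ultimately have "vac = x"
        using gr_Int xy(3) by auto
      then obtain e where "e \<in> gr 1" "vac + e \<in> W"
        using xy(1) by (auto simp: A_def)
      then show ?thesis
        using vac_plus_odd_mem_imp_UNIV[OF W hom] by blast
    qed
  qed
  then show "simple_module mode_algebra"
    unfolding simple_module_mode_algebra_iff by blast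
qed

end

theorem lemma3p4:
  fixes scale :: "complex \<Rightarrow> 'v::ab_group_add \<Rightarrow> 'v"
    and gr :: "bit \<Rightarrow> 'v set"
    and Y :: "'v \<Rightarrow> int \<Rightarrow> 'v \<Rightarrow> 'v"
    and vac :: 'v
  assumes "vertex_superalgebra scale gr Y vac"
  shows "vertex_superalgebra.simple_vertex_superalgebra scale gr Y \<longleftrightarrow>
    vector_space.simple_module scale (vertex_superalgebra.mode_algebra scale Y vac)"
  by (rule vertex_superalgebra.simple_iff_simple_module[OF assms])

end
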